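(* Let $g : [f_1^{\min}, f_1^{\max}] \to \mathbb{R}$ be a strictly convex differentiable function, with derivative $g'$, whose graph $f_2 = g(f_1)$ represents a Pareto front in the $(f_1,f_2)$-plane (so $g$ is monotonically decreasing), and let $(f_1^u, g(f_1^u))$, with $f_1^u \in [f_1^{\min}, f_1^{\max}]$, be a user-specified point on it. Assume that the optimal weights $\boldsymbol{w}^\star = (w_1^\star, w_2^\star)$, $w_1^\star + w_2^\star = 1$, are defined such that the single weighted metric $w_1^\star f_1 + w_2^\star f_2$, to be minimized subject to $f_2 \geq g(f_1)$, achieves optimality at the user-specified point $(f_1^u, g(f_1^u))$. Then the optimal weights are $$\boldsymbol{w}^\star = \left(-\frac{g'(f_1^u)}{1 - g'(f_1^u)},\ \frac{1}{1 - g'(f_1^u)}\right).$$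
   Context: There are two real-valued metrics $f_1, f_2$, both to be minimized, and $f_1^{\min}, f_1^{\max}$ are the minimum and maximum of the first metric. The metrics are combined into a single weighted metric $w_1 f_1 + w_2 f_2$ with a weight vector $\boldsymbol{w} = (w_1, w_2)$ subject to $w_1 + w_2 = 1$. The Pareto front is the curve on which the non-dominated metric pairs are supposed to lie, where a pair dominates another if it is no larger in both metrics and strictly smaller in at least one.
   Formalization: At the endpoints f_1^u = f_1^min or f_1^max other weights are optimal too (e.g. (1,0) at f_1^min), so there the stated weights are only shown to be optimal; that they are the only optimal weights is shown for f_1^u strictly between f_1^min and f_1^max. *)

theory Defs
  imports "HOL-Analysis.Analysis"
begin

definition strictly_convex_on :: "real set \<Rightarrow> (real \<Rightarrow> real) \<Rightarrow> bool" where
  "strictly_convex_on S f \<longleftrightarrow> convex S \<and>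
     (\<forall>x\<in>S. \<forall>y\<in>S. \<forall>u>0. \<forall>v>0. x \<noteq> y \<longrightarrow> u + v = 1 \<longrightarrow>
        f (u * x + v * y) < u * f x + v * f y)"

text \<open>Both metrics are minimized, so smaller is better in each component.\<close>

definition dominates :: "real \<times> real \<Rightarrow> real \<times> real \<Rightarrow> bool" where
  "dominates p q \<longleftrightarrow> fst p \<le> fst q \<and> snd p \<le> snd q \<and> (fst p < fst q \<or> snd p < snd q)"

definition pareto_front :: "(real \<times> real) set \<Rightarrow> (real \<times> real) set" where
  "pareto_front F = {p \<in> F. \<not> (\<exists>q\<in>F. dominates q p)}"

definition weighted_metric :: "real \<times> real \<Rightarrow> real \<times> real \<Rightarrow> real" where
  "weighted_metric w p = fst w * fst p + snd w * snd p"

text \<open>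
  The region of the metric pairs subject to f2 >= g(f1), with f1 in the domain S of g, is
  the library's \<^term>\<open>epigraph S g\<close>.  The weights are only required to sum to 1; they
  are not assumed to be nonnegative.
\<close>

definition optimal_weights ::
    "real set \<Rightarrow> (real \<Rightarrow> real) \<Rightarrow> real \<Rightarrow> real \<times> real \<Rightarrow> bool" where
  "optimal_weights S g u w \<longleftrightarrow> fst w + snd w = 1 \<and>
     is_arg_min (weighted_metric w) (\<lambda>p. p \<in> epigraph S g) (u, g u)"

end

theory Submission
  imports Defs
begin

text \<open>
  Minimality of the front makes g decreasing, so its derivative m at the chosen point u is
  nonpositive and 1 - m > 0.  Up to this positive factor the proposed weights are (-m, 1), and
  minimality of f2 - m f1 over the epigraph says that the convex function g lies above its tangent
  at u.  For uniqueness, the weighted metric restricted to the graph has a local minimum at an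
  interior u, hence w1 + w2 m = 0, which with w1 + w2 = 1 determines w.
\<close>

lemma strictly_convex_on_imp_convex_on:
  assumes "strictly_convex_on S f"
  shows "convex_on S f"
proof (rule convex_onI)
  show "convex S"
    using assms by (simp add: strictly_convex_on_def)
next
  fix t x y :: real
  assume t: "0 < t" "t < 1" and xy: "x \<in> S" "y \<in> S"
  show "f ((1 - t) *\<^sub>R x + t *\<^sub>R y) \<le> (1 - t) * f x + t * f y"
  \<comment> \<open>Strict convexity speaks only of distinct points; for equal ones both sides
    agree.\<close>
  proof (cases "x = y")
    case True
    then show ?thesis by (simp add: algebra_simps)
  next
    case False
    have "1 - t > 0" "t > 0" "(1 - t) + t = 1"
      using t by auto
    then have "f ((1 - t) * x + t * y) < (1 - t) * f x + t * f y"
      using assms xy False unfolding strictly_convex_on_def by blast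
    then show ?thesis by simp
  qed
qed

text \<open>
  Unlike the library's \<open>convex_on_imp_above_tangent\<close>, this allows the point of tangency to lie on
  the boundary of the domain; the derivative is taken along the segment towards y.
\<close>
lemma convex_on_above_tangent_within:
  fixes f :: "real \<Rightarrow> real"
  assumes conv: "convex_on S f"
    and deriv: "(f has_real_derivative m) (at u within S)"
    and u: "u \<in> S" and y: "y \<in> S"
  shows "f u + m * (y - u) \<le> f y"
proof -
  define p where "p t = u + t * (y - u)" for t
  have p_convex: "p t = (1 - t) *\<^sub>R u + t *\<^sub>R y" for t
    by (simp add: p_def algebra_simps)
  have p_in: "p ` {0..1} \<subseteq> S"
    using convexD_alt[OF convex_on_imp_convex[OF conv] u y] unfolding p_convex by auto
  have p0: "p 0 = u"
    by (simp add: p_def)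
  have f_deriv: "(f has_real_derivative m) (at (p 0) within p ` {0..1})"
    using has_field_derivative_subset[OF deriv p_in] by (simp add: p0)
  have p_deriv: "(p has_real_derivative (y - u)) (at 0 within {0..1})"
    unfolding p_def by (auto intro!: derivative_eq_intros)
  have "((f \<circ> p) has_real_derivative m * (y - u)) (at 0 within {0..1})"
    by (rule DERIV_image_chain[OF f_deriv p_deriv])
  then have lim: "((\<lambda>t. (f (p t) - f u) / t) \<longlongrightarrow> m * (y - u)) (at 0 within {0..1})"
    by (simp add: has_field_derivative_iff p0)
  \<comment> \<open>Along the segment \<open>f\<close> stays below its chord, so every difference
    quotient at 0 is at most the chord's slope in \<open>t\<close>; the limit inherits the
    bound.\<close>
  have "(f (p t) - f u) / t \<le> f y - f u" if "t \<in> {0..1}" "t \<noteq> 0" for t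
  proof -
    have "f (p t) \<le> (1 - t) * f u + t * f y"
      using convex_onD[OF conv, of t u y] that u y by (simp add: p_convex)
    then show ?thesis
      using that by (simp add: field_simps)
  qed
  then have bound: "\<forall>\<^sub>F t in at 0 within {0..1}. (f (p t) - f u) / t \<le> f y - f u"
    by (simp add: eventually_at_filter)
  have "at (0::real) within {0..1} \<noteq> bot"
    by (simp add: trivial_limit_within islimpt_Icc)
  from tendsto_upperbound[OF lim bound this] show ?thesis
    by simp
qed

text \<open>Every difference quotient is nonpositive, and so is its limit;
  \<open>u islimpt S\<close> makes the filter nontrivial, so that the bound passes to the
  limit.\<close>

lemma antimono_on_deriv_nonpos_within:
  fixes f :: "real \<Rightarrow> real"
  assumes anti: "antimono_on S f"
    and deriv: "(f has_real_derivative m) (at u within S)"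
    and u: "u \<in> S" "u islimpt S"
  shows "m \<le> 0"
proof -
  have lim: "((\<lambda>x. (f x - f u) / (x - u)) \<longlongrightarrow> m) (at u within S)"
    using deriv by (simp add: has_field_derivative_iff)
  have "(f x - f u) / (x - u) \<le> 0" if "x \<in> S" for x
    using monotone_onD[OF anti u(1) that] monotone_onD[OF anti that u(1)]
    by (cases x u rule: linorder_cases) (auto simp: divide_le_0_iff)
  then have "\<forall>\<^sub>F x in at u within S. (f x - f u) / (x - u) \<le> 0"
    by (simp add: eventually_at_filter)
  then show ?thesis
    using tendsto_upperbound[OF lim] u(2) by (simp add: trivial_limit_within)
qed

text \<open>If \<open>x \<le> y\<close> but \<open>g x < g y\<close>, the graph point over
  \<open>x\<close> would dominate the one over \<open>y\<close>.\<close>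

lemma pareto_front_graph_imp_antimono_on:
  assumes "pareto_front (epigraph S g) = (\<lambda>x. (x, g x)) ` S"
  shows "antimono_on S g"
proof (rule monotone_onI)
  fix x y :: real
  assume xy: "x \<in> S" "y \<in> S" "x \<le> y"
  have "(y, g y) \<in> pareto_front (epigraph S g)"
    using assms xy by auto
  moreover have "(x, g x) \<in> epigraph S g"
    using xy by (simp add: epigraph_def)
  ultimately have "\<not> dominates (x, g x) (y, g y)"
    by (auto simp: pareto_front_def)
  then show "g y \<le> g x"
    using xy by (auto simp: dominates_def)
qed

lemma optimal_weights_iff:
  assumes "u \<in> S"
  shows "optimal_weights S g u w \<longleftrightarrow> fst w + snd w = 1 \<and>
    (\<forall>x\<in>S. \<forall>y\<ge>g x. fst w * u + snd w * g u \<le> fst w * x + snd w * y)"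
  using assms
  by (auto simp: optimal_weights_def is_arg_min_linorder weighted_metric_def epigraph_def)

theorem proposition1:
  fixes g g' :: "real \<Rightarrow> real" and f1min f1max f1u :: real
  assumes "f1min < f1max"
    and "strictly_convex_on {f1min..f1max} g"
    and "\<And>x. x \<in> {f1min..f1max} \<Longrightarrow>
           (g has_real_derivative g' x) (at x within {f1min..f1max})"
    and "pareto_front (epigraph {f1min..f1max} g) = (\<lambda>x. (x, g x)) ` {f1min..f1max}"
    and "f1u \<in> {f1min..f1max}"
  shows "optimal_weights {f1min..f1max} g f1u (- g' f1u / (1 - g' f1u), 1 / (1 - g' f1u)) \<and>
         (f1u \<in> {f1min<..<f1max} \<longrightarrow>
           (\<forall>w. optimal_weights {f1min..f1max} g f1u w \<longrightarrow>
              w = (- g' f1u / (1 - g' f1u), 1 / (1 - g' f1u))))"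
proof (intro conjI impI allI)
  let ?S = "{f1min..f1max}" and ?m = "g' f1u"
  note u = assms(5) and deriv = assms(3)[OF assms(5)]
  have "f1u islimpt ?S"
    using assms(1) u by (simp add: islimpt_Icc)
  then have "?m \<le> 0"
    using antimono_on_deriv_nonpos_within[OF pareto_front_graph_imp_antimono_on[OF assms(4)] deriv u]
    by simp
  then have pos: "1 - ?m > 0"
    by simp
  have "- ?m / (1 - ?m) * f1u + 1 / (1 - ?m) * g f1u
      \<le> - ?m / (1 - ?m) * x + 1 / (1 - ?m) * y" if "x \<in> ?S" "g x \<le> y" for x y
  proof -
    have "g f1u + ?m * (x - f1u) \<le> g x"
      using convex_on_above_tangent_within[OF strictly_convex_on_imp_convex_on[OF assms(2)] deriv u]
        that(1) .
    then have "- ?m * f1u + g f1u \<le> - ?m * x + y"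
      using that(2) by (simp add: algebra_simps)
    \<comment> \<open>Scaling by a positive factor preserves the minimizer and makes the weights sum
      to 1.\<close>
    then have "(- ?m * f1u + g f1u) / (1 - ?m) \<le> (- ?m * x + y) / (1 - ?m)"
      using pos by (intro divide_right_mono) auto
    then show ?thesis
      by (simp add: add_divide_distrib diff_divide_distrib)
  qed
  moreover have "- ?m / (1 - ?m) + 1 / (1 - ?m) = 1"
    using pos by (simp add: field_simps)
  ultimately show "optimal_weights ?S g f1u (- ?m / (1 - ?m), 1 / (1 - ?m))"
    using u by (simp add: optimal_weights_iff)

  fix w
  assume interior: "f1u \<in> {f1min<..<f1max}" and opt: "optimal_weights ?S g f1u w"
  have sum: "fst w + snd w = 1"
    and le: "fst w * f1u + snd w * g f1u \<le> fst w * x + snd w * g x" if "x \<in> ?S" for x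
    using opt that u by (auto simp: optimal_weights_iff)
  \<comment> \<open>At an interior point the derivative is two-sided, so a minimum forces it to
    vanish; at an endpoint only an inequality would follow.\<close>
  have "(g has_real_derivative ?m) (at f1u)"
    using deriv interior by (simp add: at_within_Icc_at)
  then have "((\<lambda>x. fst w * x + snd w * g x) has_real_derivative fst w + snd w * ?m) (at f1u)"
    by (auto intro!: derivative_eq_intros)
  moreover have "0 < min (f1u - f1min) (f1max - f1u)"
    using interior by simp
  \<comment> \<open>The radius is the distance to the nearer endpoint, which keeps \<open>x\<close>
    in the domain.\<close>
  moreover have "\<forall>x. \<bar>f1u - x\<bar> < min (f1u - f1min) (f1max - f1u) \<longrightarrow>
      fst w * f1u + snd w * g f1u \<le> fst w * x + snd w * g x"
    using le by (auto simp: abs_if split: if_splits)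
  ultimately have "fst w + snd w * ?m = 0"
    by (rule DERIV_local_min)
  \<comment> \<open>Eliminate one weight at a time from the stationarity condition and the
    normalization.\<close>
  then have "snd w * (1 - ?m) = 1" "fst w * (1 - ?m) = - ?m"
    using sum[OF u] by algebra+
  then have "snd w = 1 / (1 - ?m)" "fst w = - ?m / (1 - ?m)"
    using pos by (simp_all add: field_simps)
  then show "w = (- ?m / (1 - ?m), 1 / (1 - ?m))"
    by (simp add: prod_eq_iff)
qed

end
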